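(* Let $\mathcal M$ be a matroid on ground set $E$ and $\mathcal M^{\triangle}$ a matroid on ground set $\mathcal C(\mathcal M)$. Then $\mathcal M^{\triangle}$ is an adjoint of $\mathcal M$ if and only if $\mathcal C_B$ is a basis of $\mathcal M^{\triangle}$ for every basis $B$ of $\mathcal M$, and $\mathcal C_{\mathcal C_B,C}$ is a circuit of $\mathcal M^{\triangle}$ for every basis $B$ of $\mathcal M$ and every $C\in\mathcal C(\mathcal M)\setminus\mathcal C_B$.
   Context: Let $n=|E|$, $d=\mathrm{rank}(\mathcal M)$, $\mathcal C(\mathcal M)$ the set of circuits, $\mathcal M^*$ the dual matroid. For a basis $B$ of $\mathcal M$ and $i\in E\setminus B$, $C_{B,i}$ is the fundamental circuit (the unique circuit contained in $B\cup\{i\}$), and $\mathcal C_B=\{C_{B,i}: i\in E\setminus B\}$. $\mathcal L^*$ is the lattice of flats of $\mathcal M^*$ and $(\mathcal L^* )^{opp}$ its order dual, a finite bounded atomic graded lattice with rank $\mathrm{rank}_{opp}(F)=(n-d)-r_{\mathcal M^*}(F)$, whose atoms are the sets $E\setminus C$, $C\in\mathcal C(\mathcal M)$, identified with the circuits $C$. For a finite bounded lattice and a linear order $\omega$ on its atoms, a nonempty set $D$ of atoms is bounded below if some atom $a$ is strictly $\omega$-smaller than all $d\in D$ and $a\le\bigvee D$; a set of atoms is NBB for $\omega$ if it contains no bounded below subset; $I(\cdot)$ is the family of sets of atoms that are NBB for some linear order. Thus $I((\mathcal L^* )^{opp})$ is a family of subsets of $\mathcal C(\mathcal M)$; sets not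 in it are called dependent. For $C\notin\mathcal C_B$, $\mathcal C_{\mathcal C_B,C}$ denotes the unique minimal dependent subset of $\mathcal C_B\cup\{C\}$. A matroid $\mathcal N$ on $\mathcal C(\mathcal M)$ with lattice of flats $\mathcal L(\mathcal N)$ is an adjoint of $\mathcal M$ if the map $E\setminus C\mapsto \mathrm{cl}_{\mathcal N}(\{C\})$ is a bijection from the atoms of $(\mathcal L^* )^{opp}$ onto the atoms of $\mathcal L(\mathcal N)$ and extends to a rank-preserving order embedding $(\mathcal L^* )^{opp}\to\mathcal L(\mathcal N)$. *)

theory Defs
  imports "HOL-Algebra.Lattice"
begin

section \<open>Finite matroids\<close>

record 'a matroid_data =
  ground :: "'a set"
  indep :: "'a set \<Rightarrow> bool"

locale matroid =
  fixes M :: "'a matroid_data"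
  assumes finite_ground: "finite (ground M)"
    and indep_ground: "indep M X \<Longrightarrow> X \<subseteq> ground M"
    and indep_empty: "indep M {}"
    and indep_subset: "indep M Y \<Longrightarrow> X \<subseteq> Y \<Longrightarrow> indep M X"
    and indep_augment:
      "indep M X \<Longrightarrow> indep M Y \<Longrightarrow> card X < card Y \<Longrightarrow> \<exists>y\<in>Y - X. indep M (insert y X)"

definition bases :: "'a matroid_data \<Rightarrow> 'a set set" where
  "bases M = {B. indep M B \<and> (\<forall>X. indep M X \<longrightarrow> B \<subseteq> X \<longrightarrow> X = B)}"

definition circuits :: "'a matroid_data \<Rightarrow> 'a set set" where
  "circuits M = {C. C \<subseteq> ground M \<and> \<not> indep M C \<and> (\<forall>X. X \<subset> C \<longrightarrow> indep M X)}"

definition rank :: "'a matroid_data \<Rightarrow> 'a set \<Rightarrow> nat" where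
  "rank M X = Max (card ` {Y. Y \<subseteq> X \<and> indep M Y})"

definition cl :: "'a matroid_data \<Rightarrow> 'a set \<Rightarrow> 'a set" where
  "cl M X = {e \<in> ground M. rank M (insert e X) = rank M X}"

definition flats :: "'a matroid_data \<Rightarrow> 'a set set" where
  "flats M = {F. F \<subseteq> ground M \<and> cl M F = F}"

definition dual :: "'a matroid_data \<Rightarrow> 'a matroid_data" where
  "dual M = \<lparr>ground = ground M,
             indep = (\<lambda>X. \<exists>B\<in>bases M. X \<subseteq> ground M - B)\<rparr>"

definition fund_circuit :: "'a matroid_data \<Rightarrow> 'a set \<Rightarrow> 'a \<Rightarrow> 'a set" where
  "fund_circuit M B i = (THE C. C \<in> circuits M \<and> C \<subseteq> insert i B)"

definition fund_circuits :: "'a matroid_data \<Rightarrow> 'a set \<Rightarrow> 'a set set" where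
  "fund_circuits M B = fund_circuit M B ` (ground M - B)"


section \<open>Lattices of flats and NBB sets\<close>

definition flat_lattice :: "'a matroid_data \<Rightarrow> 'a set gorder" where
  "flat_lattice M = \<lparr>carrier = flats M, eq = (=), le = (\<subseteq>)\<rparr>"

definition dual_opp :: "'a matroid_data \<Rightarrow> 'a set gorder" where
  "dual_opp M = inv_gorder (flat_lattice (dual M))"

text \<open>The natural-number subtraction does not truncate for a matroid, since
  the rank of the dual is \<open>card (ground M) - rank M (ground M)\<close>.\<close>

definition rank_opp :: "'a matroid_data \<Rightarrow> 'a set \<Rightarrow> nat" where
  "rank_opp M F = (card (ground M) - rank M (ground M)) - rank (dual M) F"

definition atoms :: "('a, 'b) gorder_scheme \<Rightarrow> 'a set" where
  "atoms L = {a \<in> carrier L. \<bottom>\<^bsub>L\<^esub> \<sqsubset>\<^bsub>L\<^esub> a \<and>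
                \<not> (\<exists>x\<in>carrier L. \<bottom>\<^bsub>L\<^esub> \<sqsubset>\<^bsub>L\<^esub> x \<and> x \<sqsubset>\<^bsub>L\<^esub> a)}"

text \<open>A linear order on the atoms is given as a reflexive relation \<open>\<omega>\<close>; hence
  \<open>a\<close> is strictly smaller than \<open>d\<close> iff \<open>(a, d) \<in> \<omega>\<close> and \<open>a \<noteq> d\<close>.\<close>

definition bounded_below :: "('a, 'b) gorder_scheme \<Rightarrow> 'a rel \<Rightarrow> 'a set \<Rightarrow> bool" where
  "bounded_below L \<omega> D \<longleftrightarrow> D \<noteq> {} \<and> D \<subseteq> atoms L \<and>
     (\<exists>a\<in>atoms L. (\<forall>d\<in>D. (a, d) \<in> \<omega> \<and> a \<noteq> d) \<and> a \<sqsubseteq>\<^bsub>L\<^esub> \<Squnion>\<^bsub>L\<^esub>D)"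

definition NBB :: "('a, 'b) gorder_scheme \<Rightarrow> 'a rel \<Rightarrow> 'a set \<Rightarrow> bool" where
  "NBB L \<omega> X \<longleftrightarrow> X \<subseteq> atoms L \<and> \<not> (\<exists>D. D \<subseteq> X \<and> bounded_below L \<omega> D)"

definition NBB_family :: "('a, 'b) gorder_scheme \<Rightarrow> 'a set set" where
  "NBB_family L = {X. \<exists>\<omega>. linear_order_on (atoms L) \<omega> \<and> NBB L \<omega> X}"

text \<open>A circuit \<open>C\<close> of \<open>M\<close> is identified with the atom \<open>ground M - C\<close> of \<open>dual_opp M\<close>.\<close>

definition dependent :: "'a matroid_data \<Rightarrow> 'a set set \<Rightarrow> bool" where
  "dependent M D \<longleftrightarrow> D \<subseteq> circuits M \<and> (\<lambda>C. ground M - C) ` D \<notin> NBB_family (dual_opp M)"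

definition min_dependent :: "'a matroid_data \<Rightarrow> 'a set \<Rightarrow> 'a set \<Rightarrow> 'a set set" where
  "min_dependent M B C = (THE D. D \<subseteq> insert C (fund_circuits M B) \<and> dependent M D \<and>
                                 (\<forall>D'. D' \<subset> D \<longrightarrow> \<not> dependent M D'))"


section \<open>Adjoints\<close>

text \<open>The library's \<^const>\<open>order_emb\<close> does not require the map to take values in the carrier
  of the target, so this is stated separately.  The map \<open>\<lambda>A. cl N {ground M - A}\<close> sends
  the atom \<open>ground M - C\<close> to \<open>cl N {C}\<close>.\<close>

definition adjoint :: "'a matroid_data \<Rightarrow> 'a set matroid_data \<Rightarrow> bool" where
  "adjoint M N \<longleftrightarrow>
     matroid N \<and> ground N = circuits M \<and>
     bij_betw (\<lambda>A. cl N {ground M - A}) (atoms (dual_opp M)) (atoms (flat_lattice N)) \<and>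
     (\<exists>\<phi>. \<phi> ` carrier (dual_opp M) \<subseteq> carrier (flat_lattice N) \<and>
          (\<forall>A\<in>atoms (dual_opp M). \<phi> A = cl N {ground M - A}) \<and>
          order_emb (dual_opp M) (flat_lattice N) \<phi> \<and>
          (\<forall>F\<in>carrier (dual_opp M). rank N (\<phi> F) = rank_opp M F))"

end

theory Submission
  imports Defs
begin

text \<open>
  The flats of the dual matroid are the complements of the unions of circuits, so the lattice
  \<open>dual_opp M\<close> is the lattice of unions of circuits under inclusion, ranked by nullity.  A set of
  circuits is NBB for some order iff it can be enumerated so that no circuit lies in the union of
  its predecessors; hence it is dependent iff it has a nonempty subset each of whose members lies
  in the union of the others.  It follows that the minimal dependent subset attached to \<open>B\<close> and \<open>C\<close>
  consists of \<open>C\<close> and the fundamental circuits of the elements of \<open>C - B\<close>.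

  If \<open>N\<close> is an adjoint, a circuit lies in the flat assigned to a union \<open>U\<close> of circuits iff it is a
  subset of \<open>U\<close>.  Hence every NBB set is independent in \<open>N\<close>, and the ranks give the two conditions.
  Conversely, given \<open>U\<close>, choose a basis \<open>B\<close> that meets \<open>U\<close> in a basis of \<open>U\<close>.  The fundamental circuits
  of the elements of \<open>U - B\<close> are independent in \<open>N\<close>, and the two conditions say exactly that their
  closure is the set of circuits contained in \<open>U\<close>; sending \<open>U\<close> to this flat is the embedding.
\<close>

section \<open>Rank, closure and circuits\<close>

context matroid
begin

section \<open>Rank, extension of independent sets, and bases\<close>

lemma indep_finite: "indep M X \<Longrightarrow> finite X"
  using finite_ground indep_ground finite_subset by blast

lemma finite_indep_cards: "finite (card ` {Y. Y \<subseteq> X \<and> indep M Y})"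
proof -
  have "{Y. Y \<subseteq> X \<and> indep M Y} \<subseteq> Pow (ground M)"
    using indep_ground by auto
  then show ?thesis
    using finite_ground by (meson finite_Pow_iff finite_imageI finite_subset)
qed

lemma card_le_rank: "Y \<subseteq> X \<Longrightarrow> indep M Y \<Longrightarrow> card Y \<le> rank M X"
  unfolding rank_def using finite_indep_cards by (intro Max_ge) auto

lemma rank_attained: obtains Y where "Y \<subseteq> X" "indep M Y" "card Y = rank M X"
proof -
  have "rank M X \<in> card ` {Y. Y \<subseteq> X \<and> indep M Y}"
    unfolding rank_def using finite_indep_cards indep_empty by (intro Max_in) auto
  then show ?thesis using that by auto
qed

lemma rank_mono: "X \<subseteq> Y \<Longrightarrow> rank M X \<le> rank M Y"
  using rank_attained[of X] card_le_rank by (metis subset_trans)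

lemma rank_indep: "indep M X \<Longrightarrow> rank M X = card X"
  by (metis card_le_rank card_mono indep_finite order_antisym rank_attained subset_refl)

text \<open>Augmentation from an independent subset of \<open>X\<close> of full rank, repeated as
  often as \<open>rank M X - card I\<close> says.\<close>

lemma indep_extend:
  assumes "indep M I" "I \<subseteq> X"
  obtains J where "I \<subseteq> J" "J \<subseteq> X" "indep M J" "card J = rank M X"
proof -
  have "\<exists>J. I \<subseteq> J \<and> J \<subseteq> X \<and> indep M J \<and> card J = rank M X"
    using assms
  proof (induction "rank M X - card I" arbitrary: I)
    case 0
    then have "card I = rank M X" using card_le_rank[of I X] by simp
    with 0 show ?case by blast
  next
    case (Suc k)
    obtain Y where Y: "Y \<subseteq> X" "indep M Y" "card Y = rank M X" by (rule rank_attained)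
    with Suc.hyps(2) obtain y where y: "y \<in> Y - I" "indep M (insert y I)"
      using indep_augment[OF Suc.prems(1) Y(2)] by force
    have "card (insert y I) = Suc (card I)"
      using y indep_finite[OF Suc.prems(1)] by simp
    then have "k = rank M X - card (insert y I)" using Suc.hyps(2) by simp
    from Suc.hyps(1)[OF this y(2)] y Y Suc.prems show ?case by auto
  qed
  then show ?thesis using that by blast
qed

lemma basesI_card:
  assumes "indep M B" "card B = rank M (ground M)" shows "B \<in> bases M"
  unfolding bases_def
proof (intro CollectI conjI allI impI)
  fix X assume X: "indep M X" "B \<subseteq> X"
  then have "card X \<le> card B" using assms card_le_rank[of X "ground M"] indep_ground by simp
  with X show "X = B" using card_seteq indep_finite by metis
qed (fact assms)

lemma bases_iff: "B \<in> bases M \<longleftrightarrow> indep M B \<and> card B = rank M (ground M)"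
proof
  assume B: "B \<in> bases M"
  then have "indep M B" by (simp add: bases_def)
  then obtain J where "B \<subseteq> J" "indep M J" "card J = rank M (ground M)"
    using indep_extend[of B "ground M"] indep_ground by metis
  with B show "indep M B \<and> card B = rank M (ground M)" by (auto simp: bases_def)
qed (simp add: basesI_card)

lemma basis_extend:
  assumes "indep M I" obtains B where "I \<subseteq> B" "B \<in> bases M"
  using assms indep_extend[of I "ground M"] indep_ground basesI_card by metis

section \<open>Circuits and their uniqueness over an independent set\<close>

lemma circuit_subset: "C \<in> circuits M \<Longrightarrow> C \<subseteq> ground M"
  and circuit_dep: "C \<in> circuits M \<Longrightarrow> \<not> indep M C"
  and circuit_proper_indep: "C \<in> circuits M \<Longrightarrow> X \<subset> C \<Longrightarrow> indep M X"
  by (auto simp: circuits_def)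

lemma circuit_finite: "C \<in> circuits M \<Longrightarrow> finite C"
  using circuit_subset finite_ground finite_subset by blast

lemma circuit_nonempty: "C \<in> circuits M \<Longrightarrow> C \<noteq> {}"
  using circuit_dep indep_empty by blast

lemma finite_circuits: "finite (circuits M)"
  using finite_ground by (rule finite_subset[rotated, OF finite_Pow_iff[THEN iffD2]]) (auto simp: circuits_def)

lemma circuits_antichain: "C \<in> circuits M \<Longrightarrow> D \<in> circuits M \<Longrightarrow> C \<subseteq> D \<Longrightarrow> C = D"
  using circuit_dep circuit_proper_indep by blast

lemma dep_contains_circuit:
  assumes "X \<subseteq> ground M" "\<not> indep M X"
  obtains C where "C \<in> circuits M" "C \<subseteq> X"
proof -
  have "finite X" using assms finite_ground finite_subset by blast
  then have "\<exists>C\<in>circuits M. C \<subseteq> X" using assms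
  proof (induction X rule: finite_psubset_induct)
    case (psubset X)
    show ?case
    proof (cases "X \<in> circuits M")
      case False
      then obtain Y where "Y \<subset> X" "\<not> indep M Y" using psubset.prems by (auto simp: circuits_def)
      with psubset show ?thesis by (meson order_trans psubset_imp_subset)
    qed blast
  qed
  then show ?thesis using that by blast
qed

text \<open>For \<open>f\<close> in \<open>C\<close> but not in \<open>D\<close>, the independent
  set \<open>C - {f}\<close> extends inside \<open>insert e I\<close> to some \<open>J\<close> with
  at least \<open>card I\<close> elements. It must avoid \<open>f\<close>, so it is everything else
  and contains \<open>D\<close>.\<close>

lemma circuit_unique:
  assumes I: "indep M I" and C: "C \<in> circuits M" "C \<subseteq> insert e I"
    and D: "D \<in> circuits M" "D \<subseteq> insert e I"
  shows "C = D"
proof (rule ccontr)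
  assume "C \<noteq> D"
  with C D obtain f where f: "f \<in> C" "f \<notin> D" using circuits_antichain by blast
  let ?X = "insert e I"
  have e: "e \<notin> I" using C I circuit_dep indep_subset by (metis insert_absorb)
  have "indep M (C - {f})" using circuit_proper_indep[OF C(1)] f by blast
  then obtain J where J: "C - {f} \<subseteq> J" "J \<subseteq> ?X" "indep M J" "card J = rank M ?X"
    using indep_extend[of "C - {f}" ?X] C by blast
  have "card I \<le> card J" using J card_le_rank[of I ?X] I by auto
  moreover have "f \<notin> J" using J C f circuit_dep indep_subset
    by (metis insert_Diff insert_subset)
  moreover have "card (?X - {f}) = card I"
    using f C e indep_finite[OF I] by (simp add: card_Diff_singleton subset_iff)
  ultimately have "J = ?X - {f}"
    using J indep_finite[OF I] by (intro card_seteq) auto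
  then have "D \<subseteq> J" using D f by blast
  then show False using J D circuit_dep indep_subset by blast
qed

section \<open>Closure, described by circuits\<close>

lemma cl_iff:
  assumes "X \<subseteq> ground M" "e \<in> ground M"
  shows "e \<in> cl M X \<longleftrightarrow> e \<in> X \<or> (\<exists>C\<in>circuits M. e \<in> C \<and> C \<subseteq> insert e X)"
proof (cases "e \<in> X")
  case True
  then show ?thesis using assms by (simp add: cl_def insert_absorb)
next
  case False
  have "rank M (insert e X) = rank M X \<longleftrightarrow> (\<exists>C\<in>circuits M. e \<in> C \<and> C \<subseteq> insert e X)"
  proof
    assume eq: "rank M (insert e X) = rank M X"
    obtain J where J: "J \<subseteq> X" "indep M J" "card J = rank M X" by (rule rank_attained)
    have "\<not> indep M (insert e J)"
    proof
      assume "indep M (insert e J)"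
      then have "card (insert e J) \<le> rank M (insert e X)" using J by (intro card_le_rank) auto
      moreover have "e \<notin> J" using J False by blast
      ultimately show False using J eq indep_finite by simp
    qed
    moreover have "insert e J \<subseteq> ground M" using J assms by blast
    ultimately obtain C where C: "C \<in> circuits M" "C \<subseteq> insert e J"
      using dep_contains_circuit by metis
    then have "e \<in> C" using J circuit_dep indep_subset by blast
    with C J show "\<exists>C\<in>circuits M. e \<in> C \<and> C \<subseteq> insert e X" by blast
  next
    assume "\<exists>C\<in>circuits M. e \<in> C \<and> C \<subseteq> insert e X"
    then obtain C where C: "C \<in> circuits M" "e \<in> C" "C \<subseteq> insert e X" by blast
    have "indep M (C - {e})" "C - {e} \<subseteq> X" using C circuit_proper_indep[OF C(1), of "C - {e}"] by auto
    then obtain J where J: "C - {e} \<subseteq> J" "J \<subseteq> X" "indep M J" "card J = rank M X"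
      by (rule indep_extend)
    obtain K where K: "J \<subseteq> K" "K \<subseteq> insert e X" "indep M K" "card K = rank M (insert e X)"
      using indep_extend[of J "insert e X"] J by blast
    \<comment> \<open>With \<open>e\<close> in \<open>K\<close>, the whole circuit \<open>C\<close>
      would lie in the independent set \<open>K\<close>.\<close>
    have "e \<notin> K" using K J C circuit_dep indep_subset by (metis insert_Diff insert_subset order_trans)
    then have "card K \<le> rank M X" using K by (intro card_le_rank) auto
    then show "rank M (insert e X) = rank M X" using K rank_mono[of X "insert e X", OF subset_insertI] by simp
  qed
  then show ?thesis using False assms by (simp add: cl_def)
qed

lemma cl_subset_ground: "cl M X \<subseteq> ground M"
  by (auto simp: cl_def)

lemma cl_extensive: "X \<subseteq> ground M \<Longrightarrow> X \<subseteq> cl M X"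
  by (auto simp: cl_def insert_absorb)

lemma cl_mono:
  assumes "X \<subseteq> Y" "Y \<subseteq> ground M" shows "cl M X \<subseteq> cl M Y"
proof
  fix e assume e: "e \<in> cl M X"
  then have g: "e \<in> ground M" using cl_subset_ground by blast
  show "e \<in> cl M Y" using e g assms cl_iff[of X e] cl_iff[of Y e] by blast
qed

text \<open>A larger rank would let some \<open>y\<close> in the closure augment a largest
  independent subset of \<open>X\<close>, so adding \<open>y\<close> to \<open>X\<close> would raise
  the rank.\<close>

lemma rank_cl:
  assumes "X \<subseteq> ground M" shows "rank M (cl M X) = rank M X"
proof (rule ccontr)
  assume ne: "rank M (cl M X) \<noteq> rank M X"
  obtain J where J: "J \<subseteq> X" "indep M J" "card J = rank M X" by (rule rank_attained)
  obtain K where K: "K \<subseteq> cl M X" "indep M K" "card K = rank M (cl M X)" by (rule rank_attained)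
  have "card J < card K" using ne J K rank_mono[OF cl_extensive[OF assms]] by auto
  with J K obtain y where y: "y \<in> K - J" "indep M (insert y J)" using indep_augment by blast
  have "card (insert y J) \<le> rank M (insert y X)" using y J by (intro card_le_rank) auto
  then have "rank M (insert y X) \<noteq> rank M X" using y J indep_finite by simp
  then show False using y K by (auto simp: cl_def)
qed

lemma cl_idem:
  assumes "X \<subseteq> ground M" shows "cl M (cl M X) = cl M X"
proof
  show "cl M (cl M X) \<subseteq> cl M X"
  proof
    fix e assume e: "e \<in> cl M (cl M X)"
    have "rank M (insert e X) \<le> rank M (insert e (cl M X))"
      using cl_extensive[OF assms] by (intro rank_mono) auto
    also have "\<dots> = rank M X" using e rank_cl[OF assms] by (simp add: cl_def)
    finally have "rank M (insert e X) = rank M X" using rank_mono[of X "insert e X", OF subset_insertI] by simp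
    then show "e \<in> cl M X" using e by (simp add: cl_def)
  qed
qed (intro cl_extensive cl_subset_ground)

lemma cl_subset_flat: "F \<in> flats M \<Longrightarrow> X \<subseteq> F \<Longrightarrow> cl M X \<subseteq> F"
  using cl_mono[of X F] by (auto simp: flats_def)

lemma indep_insert_iff:
  assumes "indep M I" "e \<in> ground M" "e \<notin> I"
  shows "indep M (insert e I) \<longleftrightarrow> e \<notin> cl M I"
proof
  assume "indep M (insert e I)"
  then show "e \<notin> cl M I"
    using assms cl_iff[of I e] indep_ground[of I] circuit_dep indep_subset by blast
next
  assume e: "e \<notin> cl M I"
  show "indep M (insert e I)"
  proof (rule ccontr)
    assume "\<not> indep M (insert e I)"
    then obtain C where C: "C \<in> circuits M" "C \<subseteq> insert e I"
      using dep_contains_circuit[of "insert e I"] assms indep_ground by auto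
    then have "e \<in> C" using assms circuit_dep indep_subset by blast
    with C e assms show False using cl_iff[of I e] indep_ground by blast
  qed
qed

text \<open>If all other elements of \<open>C\<close> were in the closed set \<open>cl M X\<close>,
  then \<open>C\<close> would force \<open>x\<close> into it too. This is the orthogonality of
  circuits and cocircuits, applied below with \<open>X = B - {e}\<close>.\<close>

lemma circuit_meets_cl_complement:
  assumes C: "C \<in> circuits M" and x: "x \<in> C" "x \<notin> cl M X" and X: "X \<subseteq> ground M"
  obtains y where "y \<in> C" "y \<noteq> x" "y \<notin> cl M X"
proof -
  have "x \<in> cl M (cl M X)" if "C - {x} \<subseteq> cl M X"
    using that C x circuit_subset[OF C] cl_iff[of "cl M X" x] cl_subset_ground by blast
  then show ?thesis using that x cl_idem[OF X] by blast
qed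

end


section \<open>Fundamental circuits\<close>

context matroid
begin

lemma bases_indep: "B \<in> bases M \<Longrightarrow> indep M B"
  by (simp add: bases_def)

lemma bases_subset: "B \<in> bases M \<Longrightarrow> B \<subseteq> ground M"
  using bases_indep indep_ground by blast

lemma fund_circuit_ex1:
  assumes "B \<in> bases M" "i \<in> ground M - B"
  shows "\<exists>!C. C \<in> circuits M \<and> C \<subseteq> insert i B"
proof -
  have "\<not> indep M (insert i B)" using assms by (auto simp: bases_def)
  then obtain C where "C \<in> circuits M" "C \<subseteq> insert i B"
    using dep_contains_circuit[of "insert i B"] assms bases_subset by blast
  then show ?thesis using circuit_unique[OF bases_indep[OF assms(1)]] by blast
qed

lemma fund_circuit:
  assumes "B \<in> bases M" "i \<in> ground M - B"
  shows fund_circuit_circuit: "fund_circuit M B i \<in> circuits M"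
    and fund_circuit_subset: "fund_circuit M B i \<subseteq> insert i B"
    and fund_circuit_mem: "i \<in> fund_circuit M B i"
proof -
  have *: "fund_circuit M B i \<in> circuits M \<and> fund_circuit M B i \<subseteq> insert i B"
    unfolding fund_circuit_def by (rule theI'[OF fund_circuit_ex1[OF assms]])
  then show "fund_circuit M B i \<in> circuits M" "fund_circuit M B i \<subseteq> insert i B" by auto
  show "i \<in> fund_circuit M B i"
    using * circuit_dep indep_subset[OF bases_indep[OF assms(1)]] by blast
qed

lemma fund_circuit_eqI:
  assumes "B \<in> bases M" "i \<in> ground M - B" "C \<in> circuits M" "C \<subseteq> insert i B"
  shows "fund_circuit M B i = C"
  using fund_circuit_ex1[OF assms(1,2)] fund_circuit[OF assms(1,2)] assms(3,4) by blast

text \<open>Only \<open>i\<close> can be outside \<open>B\<close>, as the circuit lies in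
  \<open>insert i B\<close>. This private element gives injectivity and prevents fundamental
  circuits from covering one another.\<close>

lemma mem_fund_circuit_iff:
  assumes "B \<in> bases M" "i \<in> ground M - B" "j \<in> ground M - B"
  shows "j \<in> fund_circuit M B i \<longleftrightarrow> j = i"
  using fund_circuit_subset[OF assms(1,2)] fund_circuit_mem[OF assms(1,2)] assms(3) by blast

lemma fund_circuit_inj:
  assumes "B \<in> bases M" shows "inj_on (fund_circuit M B) (ground M - B)"
  by (intro inj_onI) (metis assms mem_fund_circuit_iff)

lemma fund_circuits_subset: "B \<in> bases M \<Longrightarrow> fund_circuits M B \<subseteq> circuits M"
  by (auto simp: fund_circuits_def fund_circuit_circuit)

text \<open>A fundamental circuit avoiding \<open>e\<close> would lie in
  \<open>insert i (B - {e})\<close> and put \<open>i\<close> into the closure. Thus \<open>i\<close>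
  in the fundamental cocircuit of \<open>e\<close> gives \<open>e\<close> in the fundamental circuit
  of \<open>i\<close>.\<close>

lemma mem_fund_circuit_if_notin_cl:
  assumes B: "B \<in> bases M" and i: "i \<in> ground M - B" and n: "i \<notin> cl M (B - {e})"
  shows "e \<in> fund_circuit M B i"
proof (rule ccontr)
  assume "e \<notin> fund_circuit M B i"
  then have "fund_circuit M B i \<subseteq> insert i (B - {e})" using fund_circuit_subset[OF B i] by blast
  then show False
    using n i fund_circuit[OF B i] cl_iff[of "B - {e}" i] bases_subset[OF B] by blast
qed

lemma notin_cl_basis_minus:
  assumes "B \<in> bases M" "e \<in> B" shows "e \<notin> cl M (B - {e})"
  using indep_insert_iff[of "B - {e}" e] assms bases_indep[OF assms(1)] bases_subset
    indep_subset[of B "B - {e}"] by (auto simp: insert_absorb)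

end

section \<open>The opposite lattice of flats of the dual\<close>

context matroid
begin

section \<open>Rank, closure and flats of the dual\<close>

lemma dual_indep: "indep (dual M) X \<longleftrightarrow> (\<exists>B\<in>bases M. X \<subseteq> ground M - B)"
  and dual_ground: "ground (dual M) = ground M"
  by (auto simp: dual_def)

text \<open>The dual rank of \<open>F\<close> is the largest \<open>card (F - B)\<close> over bases
  \<open>B\<close>. All bases have the same size, so this is attained where
  \<open>card (B - F)\<close> is largest, namely when \<open>B\<close> extends a basis of the
  complement of \<open>F\<close>.\<close>

lemma rank_dual:
  assumes F: "F \<subseteq> ground M"
  shows "rank (dual M) F + rank M (ground M) = card F + rank M (ground M - F)"
proof -
  let ?S = "{Y. Y \<subseteq> F \<and> indep (dual M) Y}"
  have finF: "finite F" using F finite_ground finite_subset by blast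
  have count: "card (F - B) + rank M (ground M) = card F + card (B - F)" if B: "B \<in> bases M" for B
  proof -
    have finB: "finite B" using B bases_indep indep_finite by blast
    have "card (F - B) + card (F \<inter> B) = card F"
      using finF by (metis add.commute card_Int_Diff)
    moreover have "card (B - F) + card (F \<inter> B) = card B"
      using finB by (metis add.commute card_Int_Diff Int_commute)
    ultimately show ?thesis using B bases_iff by simp
  qed
  obtain I where I: "I \<subseteq> ground M - F" "indep M I" "card I = rank M (ground M - F)"
    by (rule rank_attained)
  obtain B where B: "I \<subseteq> B" "B \<in> bases M" using basis_extend[OF I(2)] .
  have "card (B - F) \<le> rank M (ground M - F)"
    using bases_subset[OF B(2)] indep_subset[OF bases_indep[OF B(2)]] by (intro card_le_rank) auto
  moreover have "card I \<le> card (B - F)"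
    using B I bases_indep indep_finite by (intro card_mono) auto
  ultimately have BF: "card (B - F) = rank M (ground M - F)" using I by simp
  have mem: "F - B \<in> ?S" using B F by (auto simp: dual_indep)
  have "rank (dual M) F = card (F - B)"
    unfolding rank_def
  proof (rule Max_eqI)
    show "finite (card ` ?S)" using finF by simp
    show "card (F - B) \<in> card ` ?S" using mem by blast
    fix k assume "k \<in> card ` ?S"
    then obtain Y B' where Y: "k = card Y" "Y \<subseteq> F" "B' \<in> bases M" "Y \<subseteq> ground M - B'"
      by (auto simp: dual_indep)
    have "card Y \<le> card (F - B')" using Y finF by (intro card_mono) auto
    moreover have "card (B' - F) \<le> rank M (ground M - F)"
      using bases_subset[OF Y(3)] indep_subset[OF bases_indep[OF Y(3)]] by (intro card_le_rank) auto
    ultimately show "k \<le> card (F - B)" using count[OF Y(3)] count[OF B(2)] BF Y(1) by linarith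
  qed
  then show ?thesis using count[OF B(2)] BF by simp
qed

text \<open>By \<open>rank_dual\<close>, the rank in the opposite lattice is the nullity in
  \<open>M\<close> of the complementary set.\<close>

lemma rank_opp_eq:
  assumes "U \<subseteq> ground M"
  shows "rank_opp M (ground M - U) = card U - rank M U"
proof -
  have "finite U" using assms finite_ground finite_subset by blast
  then have "card (ground M - U) = card (ground M) - card U" "card U \<le> card (ground M)"
    using assms finite_ground by (auto simp: card_Diff_subset card_mono)
  moreover have "ground M - (ground M - U) = U" using assms by blast
  ultimately show ?thesis
    using rank_dual[of "ground M - U"] by (auto simp: rank_opp_def)
qed

text \<open>By \<open>rank_dual\<close>, adding \<open>e\<close> to \<open>F\<close> keeps the dual
  rank exactly when removing \<open>e\<close> from the complement of \<open>F\<close> lowers the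
  rank in \<open>M\<close>, that is, when no circuit inside that complement passes through
  \<open>e\<close>.\<close>

lemma cl_dual:
  assumes F: "F \<subseteq> ground M" and e: "e \<in> ground M - F"
  shows "e \<in> cl (dual M) F \<longleftrightarrow> \<not> (\<exists>C\<in>circuits M. e \<in> C \<and> C \<subseteq> ground M - F)"
proof -
  let ?X = "ground M - insert e F"
  have ins: "insert e ?X = ground M - F" using e by blast
  have fin: "finite F" using F finite_ground finite_subset by blast
  have "rank (dual M) (insert e F) + rank M (ground M) = card F + 1 + rank M ?X"
    using rank_dual[of "insert e F"] F e fin by simp
  moreover have "rank (dual M) F + rank M (ground M) = card F + rank M (insert e ?X)"
    using rank_dual[OF F] ins by simp
  moreover have "rank M ?X \<le> rank M (insert e ?X)" by (intro rank_mono) auto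
  \<comment> \<open>The rank changes by 0 or 1, so equality of the dual ranks is equivalent to a
    change in \<open>M\<close>.\<close>
  moreover have "rank M (insert e ?X) \<le> rank M ?X + 1"
  proof -
    obtain J where J: "J \<subseteq> insert e ?X" "indep M J" "card J = rank M (insert e ?X)"
      by (rule rank_attained)
    have "card (J - {e}) \<le> rank M ?X"
      using J indep_subset[OF J(2)] by (intro card_le_rank) auto
    then show ?thesis using J(3) card_Diff_singleton_if[of J e] by (auto split: if_splits)
  qed
  ultimately have "rank (dual M) (insert e F) = rank (dual M) F \<longleftrightarrow> rank M (insert e ?X) \<noteq> rank M ?X"
    by linarith
  then have "e \<in> cl (dual M) F \<longleftrightarrow> e \<notin> cl M ?X"
    using e by (simp add: cl_def dual_ground)
  also have "\<dots> \<longleftrightarrow> \<not> (\<exists>C\<in>circuits M. e \<in> C \<and> C \<subseteq> ground M - F)"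
    using cl_iff[of ?X e] e ins by auto
  finally show ?thesis .
qed

text \<open>By \<open>cl_dual\<close>, \<open>F\<close> is closed exactly when each element outside
  \<open>F\<close> lies in a circuit avoiding \<open>F\<close>.\<close>

lemma flats_dual: "F \<in> flats (dual M) \<longleftrightarrow> (\<exists>\<D>\<subseteq>circuits M. F = ground M - \<Union>\<D>)"
proof
  assume F: "F \<in> flats (dual M)"
  then have sub: "F \<subseteq> ground M" and cl: "cl (dual M) F = F" by (auto simp: flats_def dual_ground)
  let ?D = "{C \<in> circuits M. C \<subseteq> ground M - F}"
  have "F = ground M - \<Union>?D"
  proof (intro equalityI subsetI)
    fix x assume x: "x \<in> ground M - \<Union>?D"
    show "x \<in> F"
    proof (rule ccontr)
      assume F: "x \<notin> F"
      then have "\<exists>C\<in>circuits M. x \<in> C \<and> C \<subseteq> ground M - F"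
        using x cl_dual[OF sub, of x] unfolding cl by simp
      then obtain C where "C \<in> ?D" "x \<in> C" by auto
      then show False using x by blast
    qed
  next
    fix x assume "x \<in> F"
    then show "x \<in> ground M - \<Union>?D" using sub by auto
  qed
  then show "\<exists>\<D>\<subseteq>circuits M. F = ground M - \<Union>\<D>" by (intro exI[of _ ?D]) simp
next
  assume "\<exists>\<D>\<subseteq>circuits M. F = ground M - \<Union>\<D>"
  then obtain \<D> where D: "\<D> \<subseteq> circuits M" "F = ground M - \<Union>\<D>" by blast
  then have sub: "F \<subseteq> ground M" by blast
  have "x \<notin> cl (dual M) F" if x: "x \<in> ground M - F" for x
  proof -
    from x D obtain C where C: "C \<in> \<D>" "x \<in> C" by blast
    moreover have "C \<subseteq> ground M - F" using C D circuit_subset by blast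
    ultimately show ?thesis using cl_dual[OF sub x] D by blast
  qed
  moreover have "F \<subseteq> cl (dual M) F"
    using sub by (auto simp: cl_def dual_ground insert_absorb)
  moreover have "cl (dual M) F \<subseteq> ground M" by (auto simp: cl_def dual_ground)
  ultimately have "cl (dual M) F = F" by blast
  then show "F \<in> flats (dual M)" using sub by (simp add: flats_def dual_ground)
qed

section \<open>Order, atoms and joins of \<open>dual_opp M\<close>\<close>

lemma carrier_dual_opp: "carrier (dual_opp M) = {ground M - \<Union>\<D> |\<D>. \<D> \<subseteq> circuits M}"
  unfolding dual_opp_def flat_lattice_def using flats_dual by (simp add: set_eq_iff) blast

lemma le_dual_opp: "X \<sqsubseteq>\<^bsub>dual_opp M\<^esub> Y \<longleftrightarrow> Y \<subseteq> X"
  by (simp add: dual_opp_def flat_lattice_def)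

lemma lless_dual_opp: "X \<sqsubset>\<^bsub>dual_opp M\<^esub> Y \<longleftrightarrow> Y \<subset> X"
  by (auto simp: lless_def dual_opp_def flat_lattice_def)

lemma bottom_dual_opp: "\<bottom>\<^bsub>dual_opp M\<^esub> = ground M"
  unfolding bottom_def
proof (rule some_equality)
  show "least (dual_opp M) (ground M) (carrier (dual_opp M))"
    by (auto simp: least_def le_dual_opp carrier_dual_opp intro!: exI[of _ "{}"])
  then show "x = ground M" if "least (dual_opp M) x (carrier (dual_opp M))" for x
    using that by (auto simp: least_def le_dual_opp)
qed

text \<open>Atoms are the complements of the minimal nonempty unions of circuits. These are the
  single circuits, because circuits form an antichain.\<close>

lemma atoms_dual_opp: "atoms (dual_opp M) = (\<lambda>C. ground M - C) ` circuits M"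
proof (intro equalityI subsetI)
  fix A assume A: "A \<in> atoms (dual_opp M)"
  then obtain \<D> where D: "\<D> \<subseteq> circuits M" "A = ground M - \<Union>\<D>" "A \<subset> ground M"
    by (auto simp: atoms_def carrier_dual_opp bottom_dual_opp lless_dual_opp)
  then obtain C where C: "C \<in> \<D>" by blast
  have "ground M - C \<in> carrier (dual_opp M)"
    using C D by (auto simp: carrier_dual_opp intro!: exI[of _ "{C}"])
  moreover have "ground M - C \<subset> ground M"
    using circuit_nonempty[of C] circuit_subset[of C] C D(1) by auto
  moreover have "A \<subseteq> ground M - C" using C D by blast
  moreover have "\<not> A \<subset> ground M - C"
    using A calculation by (simp add: atoms_def bottom_dual_opp lless_dual_opp)
  ultimately have "A = ground M - C" by blast
  then show "A \<in> (\<lambda>C. ground M - C) ` circuits M" using C D by blast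
next
  fix A assume "A \<in> (\<lambda>C. ground M - C) ` circuits M"
  then obtain C where C: "C \<in> circuits M" "A = ground M - C" by blast
  have "A \<in> carrier (dual_opp M)"
    using C by (auto simp: carrier_dual_opp intro!: exI[of _ "{C}"])
  moreover have "A \<subset> ground M"
    using circuit_nonempty[OF C(1)] circuit_subset[OF C(1)] C(2) by auto
  moreover have False if "\<D> \<subseteq> circuits M" "ground M - \<Union>\<D> \<subset> ground M" "A \<subset> ground M - \<Union>\<D>" for \<D>
  proof -
    from that obtain D where D: "D \<in> \<D>" by blast
    then have "D \<subseteq> C" using that C circuit_subset by blast
    then have "D = C" using D that C circuits_antichain by blast
    with D that C show False by blast
  qed
  ultimately show "A \<in> atoms (dual_opp M)"
    by (auto simp: atoms_def bottom_dual_opp lless_dual_opp carrier_dual_opp)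
qed

text \<open>Upper bounds are the dual flats contained in all the given complements. The intersection
  of these complements is itself a dual flat, hence the least upper bound.\<close>

lemma sup_dual_opp:
  assumes "\<D> \<subseteq> circuits M"
  shows "\<Squnion>\<^bsub>dual_opp M\<^esub>((\<lambda>C. ground M - C) ` \<D>) = ground M - \<Union>\<D>"
proof -
  let ?U = "Upper (dual_opp M) ((\<lambda>C. ground M - C) ` \<D>)"
  have mem: "ground M - C \<in> carrier (dual_opp M)" if "C \<in> \<D>" for C
    using that assms by (auto simp: carrier_dual_opp intro!: exI[of _ "{C}"])
  have U: "?U = {X \<in> carrier (dual_opp M). \<forall>C\<in>\<D>. X \<subseteq> ground M - C}"
    using mem by (auto simp: Upper_def le_dual_opp)
  have sub: "X \<subseteq> ground M" if "X \<in> carrier (dual_opp M)" for X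
    using that by (auto simp: carrier_dual_opp)
  have "least (dual_opp M) (ground M - \<Union>\<D>) ?U"
    using assms sub unfolding least_def U le_dual_opp by (auto simp: carrier_dual_opp)
  moreover from this have "X = ground M - \<Union>\<D>" if "least (dual_opp M) X ?U" for X
    using that unfolding least_def le_dual_opp by (intro equalityI) auto
  ultimately show ?thesis unfolding sup_def by (rule some_equality)
qed

end

section \<open>Minimal dependent sets of circuits\<close>

text \<open>The obstruction to being NBB: in a covered set of circuits, whichever is smallest in the
  order lies below the join of the remaining ones.\<close>

definition covered :: "'a set set \<Rightarrow> bool" where
  "covered Y \<longleftrightarrow> Y \<noteq> {} \<and> (\<forall>y\<in>Y. y \<subseteq> \<Union>(Y - {y}))"

text \<open>The order is built from the front: a member of \<open>X\<close> that is not covered by the others can be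
  made the smallest element.\<close>

lemma uncovered_enumeration:
  assumes "finite S" "finite X" "X \<subseteq> S" "\<And>Y. Y \<subseteq> X \<Longrightarrow> \<not> covered Y"
  shows "\<exists>f :: 'a set \<Rightarrow> nat. inj_on f S \<and>
           (\<forall>D a. D \<subseteq> X \<longrightarrow> D \<noteq> {} \<longrightarrow> a \<in> S \<longrightarrow> a \<subseteq> \<Union>D \<longrightarrow> (\<exists>d\<in>D. f d \<le> f a))"
  using assms(2-4)
proof (induction X rule: finite_psubset_induct)
  case (psubset X)
  show ?case
  proof (cases "X = {}")
    case True
    then show ?thesis using finite_imp_inj_to_nat_seg[OF assms(1)] by auto
  next
    case False
    then obtain y where y: "y \<in> X" "\<not> y \<subseteq> \<Union>(X - {y})"
      using psubset.prems(2)[of X] by (auto simp: covered_def)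
    have "X - {y} \<subset> X" "X - {y} \<subseteq> S" using y psubset.prems by auto
    moreover have "\<not> covered Y" if "Y \<subseteq> X - {y}" for Y using that psubset.prems(2) by blast
    ultimately have "\<exists>f :: 'a set \<Rightarrow> nat. inj_on f S \<and>
           (\<forall>D a. D \<subseteq> X - {y} \<longrightarrow> D \<noteq> {} \<longrightarrow> a \<in> S \<longrightarrow> a \<subseteq> \<Union>D \<longrightarrow> (\<exists>d\<in>D. f d \<le> f a))"
      by (rule psubset.IH)
    then obtain f :: "'a set \<Rightarrow> nat" where f: "inj_on f S"
      "\<And>D a. D \<subseteq> X - {y} \<Longrightarrow> D \<noteq> {} \<Longrightarrow> a \<in> S \<Longrightarrow> a \<subseteq> \<Union>D \<Longrightarrow> \<exists>d\<in>D. f d \<le> f a"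
      by blast
    \<comment> \<open>The value 0 makes \<open>y\<close> smallest, so any \<open>D\<close>
      containing \<open>y\<close> is settled by \<open>d = y\<close>. A \<open>D\<close> without
      \<open>y\<close> cannot cover \<open>y\<close>, so there the claim for \<open>f\<close>
      carries over.\<close>
    let ?g = "\<lambda>a. if a = y then 0 else Suc (f a)"
    have "\<exists>d\<in>D. ?g d \<le> ?g a" if D: "D \<subseteq> X" "D \<noteq> {}" "a \<in> S" "a \<subseteq> \<Union>D" for D a
    proof (cases "y \<in> D")
      case False
      then have sub: "D \<subseteq> X - {y}" using D by blast
      then have "a \<noteq> y" using y D by blast
      moreover obtain d where "d \<in> D" "f d \<le> f a" using f(2)[OF sub D(2-4)] by blast
      ultimately show ?thesis using False by auto
    qed auto
    moreover have "inj_on ?g S" using f(1) by (auto simp: inj_on_def)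
    ultimately show ?thesis by (intro exI[of _ ?g]) blast
  qed
qed

context matroid
begin

section \<open>NBB sets of circuits and covered sets\<close>

text \<open>The smallest member \<open>y\<close> of \<open>Y\<close> witnesses that the remaining
  members are bounded below.\<close>

lemma not_NBB_if_covered:
  assumes X: "X \<subseteq> circuits M" and Y: "Y \<subseteq> X" "covered Y"
    and lin: "linear_order_on (atoms (dual_opp M)) \<omega>"
  shows "\<not> NBB (dual_opp M) \<omega> ((\<lambda>C. ground M - C) ` X)"
proof -
  let ?c = "\<lambda>C. ground M - C"
  have sub: "?c ` Y \<subseteq> atoms (dual_opp M)" using X Y by (auto simp: atoms_dual_opp)
  have fin: "finite (?c ` Y)" using X Y finite_circuits by (meson finite_imageI finite_subset)
  have lo: "\<omega> \<subseteq> atoms (dual_opp M) \<times> atoms (dual_opp M)" "trans \<omega>" "antisym \<omega>"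
      "refl_on (atoms (dual_opp M)) \<omega>" "total_on (atoms (dual_opp M)) \<omega>"
    using lin by (auto simp: order_on_defs)
  have "\<exists>m\<in>Z. \<forall>z\<in>Z. (m, z) \<in> \<omega>" if "finite Z" "Z \<noteq> {}" "Z \<subseteq> atoms (dual_opp M)" for Z
    using that
  proof (induction rule: finite_ne_induct)
    case (singleton x)
    then show ?case using lo(4) by (simp add: refl_on_def)
  next
    case (insert x F)
    then obtain m where m: "m \<in> F" "\<forall>z\<in>F. (m, z) \<in> \<omega>" by blast
    have "(x, x) \<in> \<omega>" "(m, x) \<in> \<omega> \<or> (x, m) \<in> \<omega>"
      using insert m lo(4,5) by (auto simp: refl_on_def total_on_def)
    then show ?case
    proof (elim disjE)
      assume "(x, m) \<in> \<omega>"
      then have "\<forall>z\<in>F. (x, z) \<in> \<omega>" using m(2) lo(2) by (blast dest: transD)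
      with \<open>(x, x) \<in> \<omega>\<close> show ?case by blast
    qed (use m in blast)
  qed
  from this[OF fin _ sub] have "\<exists>m\<in>?c ` Y. \<forall>z\<in>?c ` Y. (m, z) \<in> \<omega>"
    using Y(2) by (simp add: covered_def)
  then obtain y where y: "y \<in> Y" "\<And>z. z \<in> Y \<Longrightarrow> (?c y, ?c z) \<in> \<omega>" by blast
  have yc: "y \<in> circuits M" "y \<subseteq> \<Union>(Y - {y})" using y X Y by (auto simp: covered_def)
  \<comment> \<open>A bounded below set has to be nonempty; nothing less can cover the nonempty
    circuit \<open>y\<close>.\<close>
  have ne: "Y - {y} \<noteq> {}" using yc(2) circuit_nonempty[OF yc(1)] by force
  have neq: "?c y \<noteq> ?c z" if "z \<in> Y - {y}" for z
  proof -
    have "y \<subseteq> ground M" "z \<subseteq> ground M" using that yc X Y by (auto dest: circuit_subset)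
    then show ?thesis using that by blast
  qed
  have "bounded_below (dual_opp M) \<omega> (?c ` (Y - {y}))"
    unfolding bounded_below_def
  proof (intro conjI bexI[of _ "?c y"] ballI)
    show "?c y \<sqsubseteq>\<^bsub>dual_opp M\<^esub> \<Squnion>\<^bsub>dual_opp M\<^esub>(?c ` (Y - {y}))"
    proof -
      have "Y - {y} \<subseteq> circuits M" using X Y by blast
      then show ?thesis using yc(2) unfolding sup_dual_opp[OF \<open>Y - {y} \<subseteq> circuits M\<close>] le_dual_opp by blast
    qed
  qed (use ne sub y neq in auto)
  moreover have "?c ` (Y - {y}) \<subseteq> ?c ` X" using Y by blast
  ultimately show ?thesis unfolding NBB_def by metis
qed

text \<open>The enumeration from \<open>uncovered_enumeration\<close> is carried over to the atoms.
  No circuit then strictly precedes all members of a nonempty \<open>D\<close> inside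
  \<open>X\<close> whose union contains it.\<close>

lemma NBB_if_uncovered:
  assumes X: "X \<subseteq> circuits M" and unc: "\<And>Y. Y \<subseteq> X \<Longrightarrow> \<not> covered Y"
  shows "(\<lambda>C. ground M - C) ` X \<in> NBB_family (dual_opp M)"
proof -
  let ?c = "\<lambda>C. ground M - C"
  obtain f :: "'a set \<Rightarrow> nat" where f: "inj_on f (circuits M)"
    "\<And>D a. D \<subseteq> X \<Longrightarrow> D \<noteq> {} \<Longrightarrow> a \<in> circuits M \<Longrightarrow> a \<subseteq> \<Union>D \<Longrightarrow> \<exists>d\<in>D. f d \<le> f a"
    using uncovered_enumeration[OF finite_circuits finite_subset[OF X finite_circuits] X unc] by blast
  define \<omega> where "\<omega> = {(?c a, ?c b) |a b. a \<in> circuits M \<and> b \<in> circuits M \<and> f a \<le> f b}"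
  have inj: "a = b" if "?c a = ?c b" "a \<in> circuits M" "b \<in> circuits M" for a b
    using that circuit_subset by (metis double_diff order_refl)
  have \<omega>_iff: "(?c a, ?c b) \<in> \<omega> \<longleftrightarrow> f a \<le> f b" if "a \<in> circuits M" "b \<in> circuits M" for a b
  proof
    assume "(?c a, ?c b) \<in> \<omega>"
    then obtain a' b' where "?c a = ?c a'" "?c b = ?c b'" "a' \<in> circuits M" "b' \<in> circuits M" "f a' \<le> f b'"
      by (auto simp: \<omega>_def)
    then show "f a \<le> f b" using that inj[of a a'] inj[of b b'] by simp
  qed (use that in \<open>auto simp: \<omega>_def\<close>)
  have "linear_order_on (atoms (dual_opp M)) \<omega>"
    unfolding order_on_defs
  proof (intro conjI)
    show "\<omega> \<subseteq> atoms (dual_opp M) \<times> atoms (dual_opp M)" by (auto simp: \<omega>_def atoms_dual_opp)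
    show "refl_on (atoms (dual_opp M)) \<omega>" by (auto simp: refl_on_def atoms_dual_opp \<omega>_iff)
    show "total_on (atoms (dual_opp M)) \<omega>"
      by (auto simp: total_on_def atoms_dual_opp \<omega>_iff)
    show "trans \<omega>"
    proof (rule transI)
      fix x y z assume "(x, y) \<in> \<omega>" "(y, z) \<in> \<omega>"
      then obtain a b b' c where "x = ?c a" "y = ?c b" "y = ?c b'" "z = ?c c" "f a \<le> f b" "f b' \<le> f c"
        "a \<in> circuits M" "b \<in> circuits M" "b' \<in> circuits M" "c \<in> circuits M"
        by (auto simp: \<omega>_def)
      then show "(x, z) \<in> \<omega>" using inj[of b b'] \<omega>_iff[of a c] by auto
    qed
    show "antisym \<omega>"
    proof (rule antisymI)
      fix x y assume xy: "(x, y) \<in> \<omega>" "(y, x) \<in> \<omega>"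
      then obtain a b where ab: "x = ?c a" "y = ?c b" "a \<in> circuits M" "b \<in> circuits M"
        by (auto simp: \<omega>_def)
      with xy have "f a = f b" using \<omega>_iff by (simp add: order_antisym)
      then show "x = y" using ab f(1) by (auto simp: inj_on_def)
    qed
  qed
  moreover have "NBB (dual_opp M) \<omega> (?c ` X)"
    unfolding NBB_def
  proof (intro conjI notI)
    show "?c ` X \<subseteq> atoms (dual_opp M)" using X by (auto simp: atoms_dual_opp)
    assume "\<exists>D\<subseteq>?c ` X. bounded_below (dual_opp M) \<omega> D"
    then obtain D where D: "D \<subseteq> X" "bounded_below (dual_opp M) \<omega> (?c ` D)"
      by (metis subset_imageE)
    then obtain A where A: "A \<in> ?c ` circuits M" "\<forall>d\<in>?c ` D. (A, d) \<in> \<omega> \<and> A \<noteq> d"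
      "A \<sqsubseteq>\<^bsub>dual_opp M\<^esub> \<Squnion>\<^bsub>dual_opp M\<^esub>(?c ` D)" "D \<noteq> {}"
      unfolding bounded_below_def atoms_dual_opp by auto
    from A(1) obtain a where a: "a \<in> circuits M" "A = ?c a" by (rule imageE)
    have DC: "D \<subseteq> circuits M" using D X by blast
    have "a \<subseteq> \<Union>D"
      using A(3) a(2) circuit_subset[OF a(1)] by (auto simp: le_dual_opp sup_dual_opp[OF DC])
    then obtain d where d: "d \<in> D" "f d \<le> f a" using f(2)[OF D(1) A(4) a(1)] by blast
    \<comment> \<open>Together with \<open>f d \<le> f a\<close> this contradicts injectivity of
      \<open>f\<close>.\<close>
    then have "f a \<le> f d" "d \<noteq> a" using A(2) a DC \<omega>_iff[of a d] by auto
    with d f(1) a(1) DC show False by (auto simp: inj_on_def)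
  qed
  ultimately show ?thesis by (auto simp: NBB_family_def)
qed

lemma dependent_iff: "dependent M D \<longleftrightarrow> D \<subseteq> circuits M \<and> (\<exists>Y\<subseteq>D. covered Y)"
proof (cases "D \<subseteq> circuits M")
  case True
  have "(\<lambda>C. ground M - C) ` D \<notin> NBB_family (dual_opp M) \<longleftrightarrow> (\<exists>Y\<subseteq>D. covered Y)"
  proof
    assume "(\<lambda>C. ground M - C) ` D \<notin> NBB_family (dual_opp M)"
    then show "\<exists>Y\<subseteq>D. covered Y" using NBB_if_uncovered[OF True] by blast
  next
    assume "\<exists>Y\<subseteq>D. covered Y"
    then show "(\<lambda>C. ground M - C) ` D \<notin> NBB_family (dual_opp M)"
      using not_NBB_if_covered[OF True] by (auto simp: NBB_family_def)
  qed
  then show ?thesis using True by (simp add: dependent_def)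
qed (simp add: dependent_def)

section \<open>The unique covered set attached to a basis and a circuit\<close>

text \<open>The private element \<open>i\<close> of a fundamental circuit in \<open>Y\<close> can
  only be covered by \<open>C\<close>, which forces \<open>C\<close> into \<open>Y\<close> and
  \<open>i\<close> into \<open>C\<close>. Conversely, an element of \<open>C - B\<close> can only be
  covered by its own fundamental circuit.\<close>

lemma fund_circuits_covered_eq:
  assumes B: "B \<in> bases M" and C: "C \<in> circuits M - fund_circuits M B"
    and Y: "Y \<subseteq> insert C (fund_circuits M B)" "covered Y"
  shows "Y = insert C (fund_circuit M B ` (C - B))"
proof -
  note fund = fund_circuit_mem[OF B] mem_fund_circuit_iff[OF B]
  have CE: "C \<subseteq> ground M" using C circuit_subset by blast
  have cov: "x \<in> \<Union>(Y - {y})" if "y \<in> Y" "x \<in> y" for x y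
    using that Y(2) by (auto simp: covered_def)
  have only: "i \<in> C \<and> C \<in> Y" if i: "i \<in> ground M - B" "fund_circuit M B i \<in> Y" for i
  proof -
    obtain y where y: "y \<in> Y" "y \<noteq> fund_circuit M B i" "i \<in> y"
      using cov[OF i(2) fund(1)[OF i(1)]] by blast
    then have "y \<notin> fund_circuits M B" using fund(2) i by (auto simp: fund_circuits_def)
    then show ?thesis using y Y by blast
  qed
  have CY: "C \<in> Y"
  proof -
    obtain y where "y \<in> Y" using Y by (auto simp: covered_def)
    then show ?thesis using Y only by (auto simp: fund_circuits_def)
  qed
  have "fund_circuit M B i \<in> Y" if i: "i \<in> C - B" for i
  proof -
    obtain y where y: "y \<in> Y" "y \<noteq> C" "i \<in> y" using cov[OF CY] i by blast
    then obtain j where "y = fund_circuit M B j" "j \<in> ground M - B"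
      using Y by (auto simp: fund_circuits_def)
    then show ?thesis using y fund(2) i CE by auto
  qed
  moreover have "y \<in> insert C (fund_circuit M B ` (C - B))" if "y \<in> Y" for y
    using that Y only by (auto simp: fund_circuits_def)
  ultimately show ?thesis using CY by blast
qed

text \<open>The fundamental cocircuit of \<open>e \<in> B\<close>, the complement of \<open>cl M (B - {e})\<close>, meets no
  circuit in exactly one element.\<close>

lemma fund_circuits_covered:
  assumes B: "B \<in> bases M" and C: "C \<in> circuits M - fund_circuits M B"
  shows "covered (insert C (fund_circuit M B ` (C - B)))"
proof -
  let ?Y = "insert C (fund_circuit M B ` (C - B))"
  note fund = fund_circuit[OF B]
  have CC: "C \<in> circuits M" and CE: "C \<subseteq> ground M" using C circuit_subset by auto
  have neC: "fund_circuit M B i \<noteq> C" if "i \<in> C - B" for i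
    using that C CE by (auto simp: fund_circuits_def)
  have neF: "fund_circuit M B i \<noteq> fund_circuit M B j" if "i \<in> C - B" "j \<in> C - B" "i \<noteq> j" for i j
    using that fund_circuit_inj[OF B] CE by (auto simp: inj_on_def)
  have ex: "\<exists>z\<in>?Y. z \<noteq> y \<and> e \<in> z" if y: "y \<in> ?Y" and e: "e \<in> y" for e y
  proof (cases "e \<in> B")
    case False
    show ?thesis
    proof (cases "y = C")
      case True
      then show ?thesis
        using False e neC[of e] fund(3)[of e] CE by (intro bexI[of _ "fund_circuit M B e"]) auto
    next
      case ne: False
      then obtain i where i: "i \<in> C - B" "y = fund_circuit M B i" using y by blast
      then have "e = i" using fund(2)[of i] CE e False by blast
      then show ?thesis using i ne by (intro bexI[of _ C]) auto
    qed
  next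
    case True
    \<comment> \<open>The complement of \<open>?H\<close> contains \<open>e\<close> and no other
      element of \<open>B\<close>.\<close>
    let ?H = "cl M (B - {e})"
    have BE: "B - {e} \<subseteq> ground M" using bases_subset[OF B] by blast
    have e_notin: "e \<notin> ?H" using notin_cl_basis_minus[OF B True] .
    have BH: "x = e" if "x \<in> B" "x \<notin> ?H" for x using that cl_extensive[OF BE] by blast
    show ?thesis
    proof (cases "y = C")
      case yC: True
      obtain x where x: "x \<in> C" "x \<noteq> e" "x \<notin> ?H"
        using circuit_meets_cl_complement[OF CC _ e_notin BE] e yC by blast
      then have "x \<in> C - B" using BH by blast
      moreover from this have "e \<in> fund_circuit M B x"
        using mem_fund_circuit_if_notin_cl[OF B _ x(3)] CE by blast
      ultimately show ?thesis using neC[of x] yC by (intro bexI[of _ "fund_circuit M B x"]) auto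
    next
      case False
      then obtain i where i: "i \<in> C - B" "y = fund_circuit M B i" using y by blast
      have iE: "i \<in> ground M - B" using i CE by blast
      obtain x where x: "x \<in> y" "x \<noteq> e" "x \<notin> ?H"
        using circuit_meets_cl_complement[OF fund(1)[OF iE] _ e_notin BE] e i by blast
      then have "x = i" using fund(2)[OF iE] i BH by blast
      then have iH: "i \<notin> ?H" using x by blast
      \<comment> \<open>The cocircuit meets \<open>C\<close> in \<open>i\<close>, hence in a second
        element \<open>z\<close>. If \<open>z\<close> is in \<open>B\<close> it equals
        \<open>e\<close>, so \<open>C\<close> covers \<open>e\<close>; otherwise the fundamental
        circuit of \<open>z\<close> does.\<close>
      obtain z where z: "z \<in> C" "z \<noteq> i" "z \<notin> ?H"
        using circuit_meets_cl_complement[OF CC _ iH BE] i by blast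
      show ?thesis
      proof (cases "z \<in> B")
        case True
        then show ?thesis using z BH[of z] False by (intro bexI[of _ C]) auto
      next
        case zB: False
        then have "e \<in> fund_circuit M B z"
          using mem_fund_circuit_if_notin_cl[OF B _ z(3)] z CE by blast
        then show ?thesis
          using zB z i neF[of z i] by (intro bexI[of _ "fund_circuit M B z"]) auto
      qed
    qed
  qed
  show ?thesis
    unfolding covered_def
  proof (intro conjI ballI subsetI)
    fix y e assume ye: "y \<in> ?Y" "e \<in> y"
    from ex[OF ye] obtain z where "z \<in> ?Y" "z \<noteq> y" "e \<in> z" by (elim bexE conjE)
    then show "e \<in> \<Union>(?Y - {y})" by (intro UnionI[of z]) simp_all
  qed simp
qed

text \<open>As \<open>?Y\<close> is the only covered subset available, a subset of
  \<open>insert C (fund_circuits M B)\<close> is dependent exactly when it contains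
  \<open>?Y\<close>.\<close>

lemma min_dependent_eq:
  assumes B: "B \<in> bases M" and C: "C \<in> circuits M - fund_circuits M B"
  shows "min_dependent M B C = insert C (fund_circuit M B ` (C - B))" (is "_ = ?Y")
proof -
  have Y: "?Y \<subseteq> insert C (fund_circuits M B)"
    using C circuit_subset by (auto simp: fund_circuits_def)
  have sub: "insert C (fund_circuits M B) \<subseteq> circuits M"
    using C fund_circuits_subset[OF B] by blast
  have dep: "D \<subseteq> insert C (fund_circuits M B) \<Longrightarrow> dependent M D \<longleftrightarrow> ?Y \<subseteq> D" for D
  proof
    assume D: "D \<subseteq> insert C (fund_circuits M B)" "dependent M D"
    then obtain Z where Z: "Z \<subseteq> D" "covered Z" by (auto simp: dependent_iff)
    then have "Z = ?Y" using D by (intro fund_circuits_covered_eq[OF B C]) simp_all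
    then show "?Y \<subseteq> D" using Z by simp
  next
    assume D: "D \<subseteq> insert C (fund_circuits M B)" "?Y \<subseteq> D"
    show "dependent M D"
      unfolding dependent_iff
    proof (intro conjI exI[of _ ?Y])
      show "D \<subseteq> circuits M" using D(1) sub by (rule subset_trans)
    qed (fact D fund_circuits_covered[OF B C])+
  qed
  show ?thesis unfolding min_dependent_def
  proof (rule the_equality)
    show "?Y \<subseteq> insert C (fund_circuits M B) \<and> dependent M ?Y \<and> (\<forall>D'. D' \<subset> ?Y \<longrightarrow> \<not> dependent M D')"
    proof (intro conjI allI impI)
      show "dependent M ?Y" using dep[OF Y] by simp
      fix D' assume D': "D' \<subset> ?Y"
      then have "D' \<subseteq> insert C (fund_circuits M B)" using Y by (meson order.trans psubset_imp_subset)
      then show "\<not> dependent M D'" using dep[of D'] D' by (simp add: less_le_not_le)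
    qed (fact Y)
    fix D assume D: "D \<subseteq> insert C (fund_circuits M B) \<and> dependent M D \<and> (\<forall>D'. D' \<subset> D \<longrightarrow> \<not> dependent M D')"
    then have "?Y \<subseteq> D" "dependent M ?Y" using dep[of D] dep[OF Y] by simp_all
    then show "D = ?Y" using D by (metis psubsetI)
  qed
qed

end

section \<open>Adjoints\<close>

lemma weak_partial_order_flat_lattice: "weak_partial_order (flat_lattice N)"
  and weak_partial_order_dual_opp: "weak_partial_order (dual_opp M)"
  by (unfold_locales; auto simp: flat_lattice_def dual_opp_def)+

context matroid
begin

text \<open>For \<open>C\<close> outside \<open>fund_circuits M B\<close>, this is the covering of
  \<open>C\<close> by the other members of its minimal dependent set.\<close>

lemma circuit_subset_fund_circuits:
  assumes B: "B \<in> bases M" and C: "C \<in> circuits M"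
  shows "C \<subseteq> \<Union>(fund_circuit M B ` (C - B))"
proof (cases "C \<in> fund_circuits M B")
  case True
  then obtain i where "i \<in> ground M - B" "C = fund_circuit M B i"
    by (auto simp: fund_circuits_def)
  then show ?thesis using fund_circuit_mem[OF B] by blast
next
  case False
  let ?Y = "insert C (fund_circuit M B ` (C - B))"
  have "covered ?Y" using fund_circuits_covered[OF B] C False by simp
  then have "C \<subseteq> \<Union>(?Y - {C})" unfolding covered_def by (meson insertI1)
  then show ?thesis by auto
qed

text \<open>Here \<open>U - B = S\<close>, and each \<open>i\<close> in \<open>S\<close> is in the
  closure of \<open>U \<inter> B\<close> through its fundamental circuit. So
  \<open>U \<inter> B\<close> is a basis of \<open>U\<close>, and the nullity counts
  \<open>S\<close>.\<close>

lemma nullity_fund_circuits: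
  assumes B: "B \<in> bases M" and S: "S \<subseteq> ground M - B"
  defines "U \<equiv> \<Union>(fund_circuit M B ` S)"
  shows "card U - rank M U = card S"
proof -
  have sub: "fund_circuit M B i \<subseteq> insert i B" "i \<in> fund_circuit M B i"
    "fund_circuit M B i \<in> circuits M" if "i \<in> S" for i
    using fund_circuit[OF B, of i] that S by auto
  have BE: "B \<subseteq> ground M" and UE: "U \<subseteq> ground M"
    using bases_subset[OF B] sub(3) circuit_subset unfolding U_def by blast+
  have SU: "S \<subseteq> U" unfolding U_def using sub(2) by blast
  have UB: "U - B = S" using SU sub(1) S unfolding U_def by blast
  have "i \<in> cl M (U \<inter> B)" if i: "i \<in> S" for i
  proof -
    have "fund_circuit M B i \<subseteq> insert i (U \<inter> B)" using sub(1)[OF i] i unfolding U_def by blast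
    then show ?thesis
      using cl_iff[of "U \<inter> B" i] sub[OF i] i S BE by blast
  qed
  moreover have "U \<inter> B \<subseteq> cl M (U \<inter> B)" using BE by (intro cl_extensive) blast
  ultimately have "U \<subseteq> cl M (U \<inter> B)" using UB by blast
  then have "rank M U \<le> rank M (U \<inter> B)"
    using rank_mono rank_cl[of "U \<inter> B"] BE by (metis le_infI2)
  moreover have "rank M (U \<inter> B) = card (U \<inter> B)"
    using indep_subset[OF bases_indep[OF B]] by (intro rank_indep) simp
  moreover have "rank M (U \<inter> B) \<le> rank M U" by (intro rank_mono) simp
  moreover have "card U = card (U \<inter> B) + card S"
    using UB UE finite_ground finite_subset card_Int_Diff by metis
  ultimately show ?thesis by linarith
qed

section \<open>From an adjoint to the two conditions\<close>

text \<open>The embedding is rewritten in terms of unions of circuits. A flat contains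
  \<open>C\<close> iff it contains \<open>cl N {C}\<close>, the image of the atom of
  \<open>C\<close>, so order embedding turns membership into inclusion.\<close>

lemma adjoint_flat_map:
  assumes "adjoint M N"
  obtains \<Phi> where
    "\<And>\<D>. \<D> \<subseteq> circuits M \<Longrightarrow> \<Phi> (\<Union>\<D>) \<in> flats N"
    "\<And>\<D>. \<D> \<subseteq> circuits M \<Longrightarrow> rank N (\<Phi> (\<Union>\<D>)) = card (\<Union>\<D>) - rank M (\<Union>\<D>)"
    "\<And>\<D> C. \<D> \<subseteq> circuits M \<Longrightarrow> C \<in> circuits M \<Longrightarrow> C \<in> \<Phi> (\<Union>\<D>) \<longleftrightarrow> C \<subseteq> \<Union>\<D>"
proof -
  from assms interpret N: matroid N by (simp add: adjoint_def)
  have gN: "ground N = circuits M" using assms by (simp add: adjoint_def)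
  obtain \<phi> where \<phi>: "\<phi> ` carrier (dual_opp M) \<subseteq> flats N"
     "\<And>C. C \<in> circuits M \<Longrightarrow> \<phi> (ground M - C) = cl N {ground M - (ground M - C)}"
     "\<And>X Y. X \<in> carrier (dual_opp M) \<Longrightarrow> Y \<in> carrier (dual_opp M) \<Longrightarrow> \<phi> X \<subseteq> \<phi> Y \<longleftrightarrow> Y \<subseteq> X"
     "\<And>F. F \<in> carrier (dual_opp M) \<Longrightarrow> rank N (\<phi> F) = rank_opp M F"
    using assms by (auto simp: adjoint_def order_emb_def flat_lattice_def le_dual_opp atoms_dual_opp)
  have car: "ground M - \<Union>\<D> \<in> carrier (dual_opp M)" if "\<D> \<subseteq> circuits M" for \<D>
    using that by (auto simp: carrier_dual_opp)
  have sub: "\<Union>\<D> \<subseteq> ground M" if "\<D> \<subseteq> circuits M" for \<D>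
    using that circuit_subset by blast
  show ?thesis
  proof (rule that[of "\<lambda>U. \<phi> (ground M - U)"])
    fix \<D> assume D: "\<D> \<subseteq> circuits M"
    show flat: "\<phi> (ground M - \<Union>\<D>) \<in> flats N" using \<phi>(1) car[OF D] by blast
    show "rank N (\<phi> (ground M - \<Union>\<D>)) = card (\<Union>\<D>) - rank M (\<Union>\<D>)"
      using \<phi>(4)[OF car[OF D]] rank_opp_eq[OF sub[OF D]] by simp
    fix C assume C: "C \<in> circuits M"
    have CE: "C \<subseteq> ground M" using circuit_subset[OF C] .
    have carC: "ground M - C \<in> carrier (dual_opp M)" using car[of "{C}"] C by simp
    have \<phi>C: "\<phi> (ground M - C) = cl N {C}" using \<phi>(2)[OF C] CE by (simp add: double_diff)
    have "C \<in> \<phi> (ground M - \<Union>\<D>) \<longleftrightarrow> cl N {C} \<subseteq> \<phi> (ground M - \<Union>\<D>)"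
      using N.cl_subset_flat[OF flat, of "{C}"] N.cl_extensive[of "{C}"] C gN by auto
    also have "\<dots> \<longleftrightarrow> ground M - \<Union>\<D> \<subseteq> ground M - C"
      using \<phi>(3)[OF carC car[OF D]] \<phi>C by simp
    also have "\<dots> \<longleftrightarrow> C \<subseteq> \<Union>\<D>" using CE by blast
    finally show "C \<in> \<phi> (ground M - \<Union>\<D>) \<longleftrightarrow> C \<subseteq> \<Union>\<D>" .
  qed
qed

text \<open>Remove a member \<open>y\<close> not covered by the rest. The flat assigned to the union
  of the rest contains the rest but not \<open>y\<close>, so adding \<open>y\<close> back keeps
  independence.\<close>

lemma adjoint_indep_if_uncovered:
  assumes adj: "adjoint M N" and X: "X \<subseteq> circuits M" "\<And>Y. Y \<subseteq> X \<Longrightarrow> \<not> covered Y"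
  shows "indep N X"
proof -
  from adj interpret N: matroid N by (simp add: adjoint_def)
  have gN: "ground N = circuits M" using adj by (simp add: adjoint_def)
  obtain \<Phi> where \<Phi>: "\<And>\<D>. \<D> \<subseteq> circuits M \<Longrightarrow> \<Phi> (\<Union>\<D>) \<in> flats N"
    "\<And>\<D> C. \<D> \<subseteq> circuits M \<Longrightarrow> C \<in> circuits M \<Longrightarrow> C \<in> \<Phi> (\<Union>\<D>) \<longleftrightarrow> C \<subseteq> \<Union>\<D>"
    using adjoint_flat_map[OF adj] by metis
  have "finite X" using X(1) finite_circuits finite_subset by blast
  then show ?thesis using X
  proof (induction X rule: finite_psubset_induct)
    case (psubset X)
    show ?case
    proof (cases "X = {}")
      case False
      then obtain y where y: "y \<in> X" "\<not> y \<subseteq> \<Union>(X - {y})"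
        using psubset.prems(2)[of X] by (auto simp: covered_def)
      have sub: "X - {y} \<subseteq> circuits M" "y \<in> circuits M" using y psubset.prems by auto
      have "indep N (X - {y})"
      proof (rule psubset.IH)
        show "X - {y} \<subset> X" using y by blast
        fix Y assume "Y \<subseteq> X - {y}"
        then show "\<not> covered Y" using psubset.prems(2)[of Y] by blast
      qed fact
      moreover have "y \<notin> cl N (X - {y})"
      proof -
        have "X - {y} \<subseteq> \<Phi> (\<Union>(X - {y}))"
        proof
          fix C assume C: "C \<in> X - {y}"
          then show "C \<in> \<Phi> (\<Union>(X - {y}))" using \<Phi>(2)[OF sub(1), of C] sub(1) by blast
        qed
        then have "cl N (X - {y}) \<subseteq> \<Phi> (\<Union>(X - {y}))" by (rule N.cl_subset_flat[OF \<Phi>(1)[OF sub(1)]])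
        then show ?thesis using y(2) \<Phi>(2)[OF sub] by blast
      qed
      ultimately have "indep N (insert y (X - {y}))"
        using N.indep_insert_iff[of "X - {y}" y] sub(2) gN by simp
      then show ?thesis using y by (simp add: insert_absorb)
    qed (simp add: N.indep_empty)
  qed
qed

text \<open>All of \<open>X\<close> lies in the flat assigned to the union of the fundamental
  circuits, whose rank is the nullity \<open>card S\<close>.\<close>

lemma adjoint_rank_le:
  assumes adj: "adjoint M N" and B: "B \<in> bases M" and S: "S \<subseteq> ground M - B"
    and X: "X \<subseteq> circuits M" "\<Union>X \<subseteq> \<Union>(fund_circuit M B ` S)"
  shows "rank N X \<le> card S"
proof -
  from adj interpret N: matroid N by (simp add: adjoint_def)
  let ?D = "fund_circuit M B ` S"
  have D: "?D \<subseteq> circuits M" using fund_circuit_circuit[OF B] S by blast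
  obtain \<Phi> where \<Phi>: "rank N (\<Phi> (\<Union>?D)) = card (\<Union>?D) - rank M (\<Union>?D)"
    "\<And>C. C \<in> circuits M \<Longrightarrow> C \<in> \<Phi> (\<Union>?D) \<longleftrightarrow> C \<subseteq> \<Union>?D"
    using adjoint_flat_map[OF adj] D by metis
  have "X \<subseteq> \<Phi> (\<Union>?D)"
  proof
    fix C assume "C \<in> X"
    then have "C \<in> circuits M" "C \<subseteq> \<Union>?D" using X by auto
    then show "C \<in> \<Phi> (\<Union>?D)" using \<Phi>(2) by simp
  qed
  then show ?thesis using N.rank_mono \<Phi>(1) nullity_fund_circuits[OF B S] by metis
qed

text \<open>Private elements exclude covered subsets, which gives independence;
  \<open>adjoint_rank_le\<close> with \<open>S = ground M - B\<close> shows that the size is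
  maximal.\<close>

lemma adjoint_fund_circuits_basis:
  assumes adj: "adjoint M N" and B: "B \<in> bases M"
  shows "fund_circuits M B \<in> bases N"
proof (rule matroid.basesI_card)
  show "matroid N" using adj by (simp add: adjoint_def)
  then interpret N: matroid N .
  have gN: "ground N = circuits M" using adj by (simp add: adjoint_def)
  show ind: "indep N (fund_circuits M B)"
  proof (rule adjoint_indep_if_uncovered[OF adj fund_circuits_subset[OF B]])
    fix Y assume Y: "Y \<subseteq> fund_circuits M B"
    show "\<not> covered Y"
    proof
      assume c: "covered Y"
      then obtain y where "y \<in> Y" by (auto simp: covered_def)
      moreover from this obtain i where "i \<in> ground M - B" "y = fund_circuit M B i"
        using Y by (auto simp: fund_circuits_def)
      ultimately have i: "i \<in> ground M - B" "fund_circuit M B i \<in> Y" by simp_all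
      then have "i \<in> \<Union>(Y - {fund_circuit M B i})"
        using c fund_circuit_mem[OF B i(1)] by (auto simp: covered_def)
      then obtain j where "j \<in> ground M - B" "i \<in> fund_circuit M B j" "j \<noteq> i"
        using Y by (auto simp: fund_circuits_def)
      then show False using mem_fund_circuit_iff[OF B _ i(1)] by blast
    qed
  qed
  have "C \<subseteq> \<Union>(fund_circuit M B ` (ground M - B))" if "C \<in> circuits M" for C
    using circuit_subset_fund_circuits[OF B that] circuit_subset[OF that] by blast
  then have "rank N (circuits M) \<le> card (ground M - B)"
    by (intro adjoint_rank_le[OF adj B]) auto
  also have "\<dots> = card (fund_circuits M B)"
    using card_image[OF fund_circuit_inj[OF B]] by (simp add: fund_circuits_def)
  finally show "card (fund_circuits M B) = rank N (ground N)"
    using N.card_le_rank[OF fund_circuits_subset[OF B] ind] gN by simp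
qed

text \<open>The set has one element more than the bound of \<open>adjoint_rank_le\<close> with
  \<open>S = C - B\<close>, so it is dependent in \<open>N\<close>. Its proper subsets have no
  covered subset, so they are independent.\<close>

lemma adjoint_min_dependent_circuit:
  assumes adj: "adjoint M N" and B: "B \<in> bases M" and C: "C \<in> circuits M - fund_circuits M B"
  shows "min_dependent M B C \<in> circuits N"
proof -
  from adj interpret N: matroid N by (simp add: adjoint_def)
  have gN: "ground N = circuits M" using adj by (simp add: adjoint_def)
  let ?F = "fund_circuit M B ` (C - B)"
  let ?Y = "insert C ?F"
  have CC: "C \<in> circuits M" and CB: "C - B \<subseteq> ground M - B" using C circuit_subset by auto
  have YF: "?Y \<subseteq> insert C (fund_circuits M B)" using CB by (auto simp: fund_circuits_def)
  have Y: "?Y \<subseteq> circuits M" using YF CC fund_circuits_subset[OF B] by blast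
  have "card ?F = card (C - B)"
    by (rule card_image[OF inj_on_subset[OF fund_circuit_inj[OF B] CB]])
  moreover have "C \<notin> ?F" using C CB by (auto simp: fund_circuits_def)
  moreover have "finite ?F" using circuit_finite[OF CC] by simp
  ultimately have "card ?Y = Suc (card (C - B))" by simp
  moreover have "rank N ?Y \<le> card (C - B)"
    using circuit_subset_fund_circuits[OF B CC] by (intro adjoint_rank_le[OF adj B CB Y]) simp
  ultimately have "\<not> indep N ?Y" using N.rank_indep by fastforce
  moreover have "indep N X" if X: "X \<subset> ?Y" for X
  proof (rule adjoint_indep_if_uncovered[OF adj])
    show "X \<subseteq> circuits M" using X Y by blast
    fix Z assume Z: "Z \<subseteq> X"
    show "\<not> covered Z"
    proof
      assume "covered Z"
      moreover have "Z \<subseteq> insert C (fund_circuits M B)" using Z X YF by (meson order.trans psubset_imp_subset)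
      ultimately have "Z = ?Y" by (intro fund_circuits_covered_eq[OF B C])
      then show False using Z X by (simp add: less_le_not_le)
    qed
  qed
  ultimately have "?Y \<in> circuits N" using Y gN unfolding circuits_def[of N] by blast
  then show ?thesis by (simp add: min_dependent_eq[OF B C])
qed

section \<open>From the two conditions to an adjoint\<close>

lemma circuits_below_flat:
  assumes "matroid N" and gN: "ground N = circuits M"
    and bas: "\<And>B. B \<in> bases M \<Longrightarrow> fund_circuits M B \<in> bases N"
    and cir: "\<And>B C. B \<in> bases M \<Longrightarrow> C \<in> circuits M - fund_circuits M B \<Longrightarrow> min_dependent M B C \<in> circuits N"
    and D: "\<D> \<subseteq> circuits M"
  defines "U \<equiv> \<Union>\<D>"
  shows "{C \<in> circuits M. C \<subseteq> U} \<in> flats N" and "rank N {C \<in> circuits M. C \<subseteq> U} = card U - rank M U"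
proof -
  interpret N: matroid N by fact
  have UE: "U \<subseteq> ground M" using D circuit_subset unfolding U_def by blast
  \<comment> \<open>\<open>B\<close> extends a basis \<open>I\<close> of \<open>U\<close>, so that
    the fundamental circuits of the elements of \<open>U - B\<close> stay inside
    \<open>U\<close>.\<close>
  obtain I where I: "I \<subseteq> U" "indep M I" "card I = rank M U" by (rule rank_attained)
  obtain B where IB: "I \<subseteq> B" and B: "B \<in> bases M" using basis_extend[OF I(2)] .
  have BU: "B \<inter> U = I"
  proof (rule sym, rule card_seteq)
    show "finite (B \<inter> U)" using indep_finite[OF bases_indep[OF B]] by simp
    show "card (B \<inter> U) \<le> card I"
      using I(3) card_le_rank[of "B \<inter> U" U] indep_subset[OF bases_indep[OF B]] by simp
  qed (use IB I in blast)
  have UB: "U - B \<subseteq> ground M - B" using UE by blast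
  let ?F = "fund_circuit M B ` (U - B)"
  have FC: "?F \<subseteq> fund_circuits M B" using UB by (auto simp: fund_circuits_def)
  have Find: "indep N ?F" using N.indep_subset[OF N.bases_indep[OF bas[OF B]] FC] .
  have FU: "fund_circuit M B i \<subseteq> U" if i: "i \<in> U - B" for i
  proof -
    have "\<not> indep M (insert i I)"
    proof
      assume "indep M (insert i I)"
      then have "card (insert i I) \<le> card I" using card_le_rank[of "insert i I" U] i I by simp
      then show False using i BU indep_finite[OF I(2)] by auto
    qed
    then obtain K where K: "K \<in> circuits M" "K \<subseteq> insert i I"
      using dep_contains_circuit[of "insert i I"] i I UE by blast
    then have "fund_circuit M B i = K" using fund_circuit_eqI[OF B, of i K] i UE IB by blast
    then show ?thesis using K i I by blast
  qed
  have eq: "cl N ?F = {C \<in> circuits M. C \<subseteq> U}"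
  proof (intro equalityI subsetI)
    fix C assume C: "C \<in> cl N ?F"
    then have CC: "C \<in> circuits M" using N.cl_subset_ground gN by blast
    have "C \<subseteq> U"
    proof (cases "C \<in> ?F")
      case True
      then show ?thesis using FU by blast
    next
      case False
      have "?F \<subseteq> ground N" using N.indep_ground[OF Find] .
      with False C CC gN obtain K where K: "K \<in> circuits N" "C \<in> K" "K \<subseteq> insert C ?F"
        using N.cl_iff[of ?F C] by auto
      have ind: "indep N (fund_circuits M B)" using N.bases_indep[OF bas[OF B]] .
      have nCB: "C \<notin> fund_circuits M B"
      proof
        assume "C \<in> fund_circuits M B"
        then have "K \<subseteq> fund_circuits M B" using K(3) FC by blast
        then show False using N.circuit_dep[OF K(1)] N.indep_subset[OF ind] by blast
      qed
      let ?G = "fund_circuit M B ` (C - B)"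
      have G: "?G \<subseteq> fund_circuits M B" using circuit_subset[OF CC] by (auto simp: fund_circuits_def)
      have "insert C ?G \<in> circuits N" using cir[OF B] min_dependent_eq[OF B] CC nCB by simp
      \<comment> \<open>Both are circuits of \<open>N\<close> inside
        \<open>insert C (fund_circuits M B)\<close>, and \<open>fund_circuits M B\<close> is
        independent in \<open>N\<close>.\<close>
      then have "insert C ?G = K"
        using N.circuit_unique[OF ind _ _ K(1), of "insert C ?G" C] G K(3) FC by blast
      then have "?G \<subseteq> ?F" using K(3) nCB G by blast
      then have "\<Union>?G \<subseteq> \<Union>?F" by (rule Union_mono)
      also have "\<dots> \<subseteq> U" using FU by blast
      finally show ?thesis using circuit_subset_fund_circuits[OF B CC] by (rule subset_trans[rotated])
    qed
    with CC show "C \<in> {C \<in> circuits M. C \<subseteq> U}" by simp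
  next
    fix C assume "C \<in> {C \<in> circuits M. C \<subseteq> U}"
    then have C: "C \<in> circuits M" "C \<subseteq> U" by auto
    show "C \<in> cl N ?F"
    proof (cases "C \<in> fund_circuits M B")
      case True
      then obtain i where i: "i \<in> ground M - B" "C = fund_circuit M B i"
        by (auto simp: fund_circuits_def)
      then have "C \<in> ?F" using C fund_circuit_mem[OF B i(1)] by blast
      then show ?thesis using N.cl_extensive[OF N.indep_ground[OF Find]] by blast
    next
      case False
      then have "insert C (fund_circuit M B ` (C - B)) \<in> circuits N"
        using cir[OF B] min_dependent_eq[OF B] C(1) by simp
      moreover have "insert C (fund_circuit M B ` (C - B)) \<subseteq> insert C ?F" using C(2) by blast
      ultimately show ?thesis
        using N.cl_iff[OF N.indep_ground[OF Find], of C] C(1) unfolding gN by blast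
    qed
  qed
  show "{C \<in> circuits M. C \<subseteq> U} \<in> flats N"
    unfolding eq[symmetric] flats_def
    using N.cl_subset_ground N.cl_idem[OF N.indep_ground[OF Find]] by simp
  have "rank N {C \<in> circuits M. C \<subseteq> U} = card ?F"
    unfolding eq[symmetric] using N.rank_cl[OF N.indep_ground[OF Find]] N.rank_indep[OF Find] by simp
  also have "\<dots> = card (U - B)"
    by (rule card_image[OF inj_on_subset[OF fund_circuit_inj[OF B] UB]])
  also have "\<dots> = card U - rank M U"
    using I BU finite_subset[OF UE finite_ground] by (metis Int_commute card_Diff_subset_Int finite_Int)
  finally show "rank N {C \<in> circuits M. C \<subseteq> U} = card U - rank M U" .
qed

text \<open>The hypotheses say that the matroid is simple, with neither loops nor parallel elements.
  It is applied to \<open>N\<close>, whose elements are circuits.\<close>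

lemma atoms_flat_lattice_singletons:
  assumes "{} \<in> flats M" and sing: "\<And>x. x \<in> ground M \<Longrightarrow> {x} \<in> flats M"
  shows "atoms (flat_lattice M) = (\<lambda>x. {x}) ` ground M"
proof -
  have bot: "\<bottom>\<^bsub>flat_lattice M\<^esub> = {}"
    unfolding bottom_def
    by (rule some_equality) (use assms(1) in \<open>auto simp: least_def flat_lattice_def\<close>)
  have less: "X \<sqsubset>\<^bsub>flat_lattice M\<^esub> Y \<longleftrightarrow> X \<subset> Y" for X Y
    by (auto simp: lless_def flat_lattice_def)
  have car: "carrier (flat_lattice M) = flats M" by (simp add: flat_lattice_def)
  show ?thesis
  proof (intro equalityI subsetI)
    fix A assume "A \<in> atoms (flat_lattice M)"
    then have A: "A \<in> flats M" "A \<noteq> {}" "\<And>X. X \<in> flats M \<Longrightarrow> X \<noteq> {} \<Longrightarrow> \<not> X \<subset> A"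
      by (auto simp: atoms_def bot less car)
    then obtain x where x: "x \<in> A" by blast
    then have g: "x \<in> ground M" using A(1) by (auto simp: flats_def)
    then have "\<not> {x} \<subset> A" using A(3)[OF sing] by simp
    then have "A = {x}" using x by blast
    then show "A \<in> (\<lambda>x. {x}) ` ground M" using g by blast
  next
    fix A assume "A \<in> (\<lambda>x. {x}) ` ground M"
    then show "A \<in> atoms (flat_lattice M)"
      using sing by (auto simp: atoms_def bot less car)
  qed
qed

text \<open>Since circuits form an antichain, the flat assigned to a single circuit \<open>C\<close>
  is \<open>{C}\<close>. Hence \<open>N\<close> is simple and the atoms correspond. A union of
  circuits is recovered from the circuits inside it, so the map is an order embedding.\<close>

lemma adjointI:
  assumes mN: "matroid N" and gN: "ground N = circuits M"
    and bas: "\<And>B. B \<in> bases M \<Longrightarrow> fund_circuits M B \<in> bases N"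
    and cir: "\<And>B C. B \<in> bases M \<Longrightarrow> C \<in> circuits M - fund_circuits M B \<Longrightarrow> min_dependent M B C \<in> circuits N"
  shows "adjoint M N"
proof -
  interpret N: matroid N by fact
  \<comment> \<open>The argument \<open>A\<close> is a dual flat, so its complement is the union of
    circuits to which the flat of \<open>N\<close> is assigned.\<close>
  define \<phi> where "\<phi> A = {C \<in> circuits M. C \<subseteq> ground M - A}" for A
  have \<phi>U: "\<phi> (ground M - \<Union>\<D>) = {C \<in> circuits M. C \<subseteq> \<Union>\<D>}" if "\<D> \<subseteq> circuits M" for \<D>
  proof -
    have "ground M - (ground M - \<Union>\<D>) = \<Union>\<D>" using that circuit_subset by blast
    then show ?thesis by (simp add: \<phi>_def)
  qed
  have \<phi>C: "\<phi> (ground M - C) = {C}" if C: "C \<in> circuits M" for C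
    using \<phi>U[of "{C}"] C circuits_antichain by auto
  have flat: "\<phi> (ground M - \<Union>\<D>) \<in> flats N" if "\<D> \<subseteq> circuits M" for \<D>
    using circuits_below_flat(1)[OF mN gN bas cir that] \<phi>U[OF that] by simp
  have sing: "{C} \<in> flats N" if "C \<in> circuits M" for C
    using flat[of "{C}"] \<phi>C[OF that] that by simp
  have "\<phi> (ground M) = {}" using circuit_nonempty by (auto simp: \<phi>_def)
  then have "{} \<in> flats N" using flat[of "{}"] by simp
  then have atoms: "atoms (flat_lattice N) = (\<lambda>C. {C}) ` circuits M"
    using N.atoms_flat_lattice_singletons sing gN by simp
  have clC: "cl N {ground M - (ground M - C)} = {C}" if C: "C \<in> circuits M" for C
  proof -
    have "cl N {C} = {C}" using sing[OF C] by (simp add: flats_def)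
    then show ?thesis using circuit_subset[OF C] by (simp add: double_diff)
  qed
  have "bij_betw (\<lambda>A. cl N {ground M - A}) (atoms (dual_opp M)) (atoms (flat_lattice N))"
    unfolding bij_betw_def atoms atoms_dual_opp
  proof
    show "inj_on (\<lambda>A. cl N {ground M - A}) ((\<lambda>C. ground M - C) ` circuits M)"
      by (auto simp: inj_on_def clC)
    show "(\<lambda>A. cl N {ground M - A}) ` (\<lambda>C. ground M - C) ` circuits M = (\<lambda>C. {C}) ` circuits M"
      unfolding image_image by (rule image_cong) (simp_all add: clC)
  qed
  moreover have "\<phi> ` carrier (dual_opp M) \<subseteq> carrier (flat_lattice N)"
    using flat by (auto simp: carrier_dual_opp flat_lattice_def)
  moreover have "\<forall>A\<in>atoms (dual_opp M). \<phi> A = cl N {ground M - A}"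
    by (auto simp: atoms_dual_opp \<phi>C clC)
  moreover have "order_emb (dual_opp M) (flat_lattice N) \<phi>"
    unfolding order_emb_def
  proof (intro conjI ballI weak_partial_order_dual_opp weak_partial_order_flat_lattice)
    fix X Y assume "X \<in> carrier (dual_opp M)" "Y \<in> carrier (dual_opp M)"
    then obtain \<D> \<E> where D: "\<D> \<subseteq> circuits M" "X = ground M - \<Union>\<D>"
      and E: "\<E> \<subseteq> circuits M" "Y = ground M - \<Union>\<E>" by (auto simp: carrier_dual_opp)
    have "\<phi> X \<subseteq> \<phi> Y \<longleftrightarrow> \<Union>\<D> \<subseteq> \<Union>\<E>"
    proof
      assume le: "\<phi> X \<subseteq> \<phi> Y"
      have "C \<subseteq> \<Union>\<E>" if C: "C \<in> \<D>" for C
      proof -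
        have "C \<in> \<phi> X" using C D \<phi>U[OF D(1)] by auto
        then have "C \<in> \<phi> Y" using le by blast
        then show ?thesis using E \<phi>U[OF E(1)] by simp
      qed
      then show "\<Union>\<D> \<subseteq> \<Union>\<E>" by (rule Union_least)
    next
      assume "\<Union>\<D> \<subseteq> \<Union>\<E>"
      then show "\<phi> X \<subseteq> \<phi> Y" using \<phi>U[OF D(1)] \<phi>U[OF E(1)] D(2) E(2) by auto
    qed
    moreover have "Y \<subseteq> X \<longleftrightarrow> \<Union>\<D> \<subseteq> \<Union>\<E>"
    proof -
      have "\<Union>\<D> \<subseteq> ground M" "\<Union>\<E> \<subseteq> ground M" using D(1) E(1) circuit_subset by blast+
      then show ?thesis unfolding D(2) E(2) by blast
    qed
    ultimately show "\<phi> X \<sqsubseteq>\<^bsub>flat_lattice N\<^esub> \<phi> Y \<longleftrightarrow> X \<sqsubseteq>\<^bsub>dual_opp M\<^esub> Y"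
      unfolding le_dual_opp by (simp add: flat_lattice_def)
  qed
  moreover have "\<forall>F\<in>carrier (dual_opp M). rank N (\<phi> F) = rank_opp M F"
  proof
    fix F assume "F \<in> carrier (dual_opp M)"
    then obtain \<D> where D: "\<D> \<subseteq> circuits M" "F = ground M - \<Union>\<D>" by (auto simp: carrier_dual_opp)
    have "\<Union>\<D> \<subseteq> ground M" using D(1) circuit_subset by blast
    then show "rank N (\<phi> F) = rank_opp M F"
      using rank_opp_eq[of "\<Union>\<D>"] circuits_below_flat(2)[OF mN gN bas cir D(1)] \<phi>U[OF D(1)] D(2) by simp
  qed
  ultimately show ?thesis
    unfolding adjoint_def using mN gN by blast
qed

end

theorem theorem5p6:
  fixes M :: "'a matroid_data" and N :: "'a set matroid_data"
  assumes "matroid M" and "matroid N" and "ground N = circuits M"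
  shows "adjoint M N \<longleftrightarrow>
    (\<forall>B\<in>bases M. fund_circuits M B \<in> bases N) \<and>
    (\<forall>B\<in>bases M. \<forall>C\<in>circuits M - fund_circuits M B. min_dependent M B C \<in> circuits N)"
proof -
  interpret matroid M by fact
  show ?thesis
    using adjoint_fund_circuits_basis adjoint_min_dependent_circuit adjointI[OF assms(2,3)] by blast
qed

end
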